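(* Let $G$ be a finite group. Then $\varphi(G)=\varphi(|G|)$ if and only if the number of cyclic subgroups of order $\exp(G)$ in $G$ is $\dfrac{|G|}{\exp(G)}$.
   Context: For a finite group $G$, $\exp(G)$ denotes its exponent (the least common multiple of the orders of its elements), $o(a)$ the order of $a\in G$, and $\varphi(G)=|\{a\in G \mid o(a)=\exp(G)\}|$. For a positive integer $n$, $\varphi(n)$ is Euler's totient of $n$. *)

theory Defs
  imports Complex_Main "HOL-Algebra.Elementary_Groups" "HOL-Algebra.Multiplicative_Group"
    "HOL-Number_Theory.Totient"
begin

definition group_exp :: "('a, 'b) monoid_scheme \<Rightarrow> nat"
  where "group_exp G = Lcm (group.ord G ` carrier G)"

definition group_phi :: "('a, 'b) monoid_scheme \<Rightarrow> nat"
  where "group_phi G = card {a \<in> carrier G. group.ord G a = group_exp G}"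

definition cyclic_subgroups_of_order :: "('a, 'b) monoid_scheme \<Rightarrow> nat \<Rightarrow> 'a set set"
  where "cyclic_subgroups_of_order G n =
    {H. subgroup H G \<and> cyclic_group (G\<lparr>carrier := H\<rparr>) \<and> card H = n}"

end

theory Submission
  imports Defs "HOL-Algebra.Sylow"
begin

text \<open>
  Sending an element of order \<open>e = exp(G)\<close> to the subgroup it generates has fibres of size
  \<open>\<phi>(e)\<close>, so \<open>\<phi>(G) = c \<phi>(e)\<close> where \<open>c\<close> is the number of cyclic subgroups of order \<open>e\<close>. By
  Lagrange and Cauchy, \<open>e\<close> divides \<open>|G|\<close> and has the same prime divisors, so Euler's product formula
  gives \<open>\<phi>(|G|) = (|G|/e) \<phi>(e)\<close>. Cancel \<open>\<phi>(e) > 0\<close>.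
\<close>

text \<open>By Euler's product, the ratio of \<open>totient k\<close> to a positive \<open>k\<close>
  is the product of \<open>1 - 1/p\<close> over the primes \<open>p\<close> dividing
  \<open>k\<close>, so it depends only on \<open>prime_factors k\<close>.\<close>

lemma totient_eq_if_prime_factors_eq:
  assumes "prime_factors m = prime_factors n" "m > 0"
  shows "real (totient n) = real n / real m * real (totient m)"
  using assms by (simp add: totient_formula2)

context group
begin

text \<open>Cauchy's theorem, from Sylow's existence theorem with exponent 1: in a subgroup of prime
  order \<open>p\<close>, the order of a non-identity element divides \<open>p\<close> and is not
  1.\<close>

lemma prime_dvd_order_imp_ord_eq:
  assumes "finite (carrier G)" "prime p" "p dvd order G"
  obtains x where "x \<in> carrier G" "ord x = p"
proof -
  obtain m where "order G = p ^ 1 * m"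
    using assms(3) by (auto elim: dvdE)
  then obtain H where H: "subgroup H G" "card H = p"
    using sylow_thm[of p G 1 m] assms is_group by auto
  have "H \<noteq> {\<one>}"
    using H(2) assms(2) by auto
  then obtain x where x: "x \<in> H" "x \<noteq> \<one>"
    using subgroup.one_closed[OF H(1)] by blast
  interpret K: group "G\<lparr>carrier := H\<rparr>"
    by (rule subgroup.subgroup_is_group[OF H(1) is_group])
  have xG: "x \<in> carrier G"
    using x(1) subgroup.subset[OF H(1)] by blast
  have "x [^] p = \<one>"
    using K.pow_order_eq_1[of x] x(1) H(2) by (simp add: order_def flip: nat_pow_consistent)
  hence "ord x dvd p"
    using pow_eq_id[OF xG] by simp
  moreover have "ord x \<noteq> 1"
    using ord_eq_1[OF xG] x(2) by simp
  ultimately have "ord x = p"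
    using assms(2) prime_nat_iff by blast
  with xG show ?thesis by (rule that)
qed

lemma ord_dvd_group_exp: "x \<in> carrier G \<Longrightarrow> ord x dvd group_exp G"
  unfolding group_exp_def by (rule dvd_Lcm) simp

lemma group_exp_dvd_order: "group_exp G dvd order G"
  unfolding group_exp_def by (rule Lcm_least) (auto intro: ord_dvd_group_order)

lemma group_exp_pos:
  assumes "finite (carrier G)"
  shows "group_exp G > 0"
  using group_exp_dvd_order assms order_gt_0_iff_finite by (metis dvd_pos_nat)

lemma prime_factors_group_exp:
  assumes "finite (carrier G)"
  shows "prime_factors (group_exp G) = prime_factors (order G)"
proof
  have n: "order G \<noteq> 0"
    using assms order_gt_0_iff_finite by simp
  show "prime_factors (group_exp G) \<subseteq> prime_factors (order G)"
    using dvd_prime_factors[OF n group_exp_dvd_order] .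
  show "prime_factors (order G) \<subseteq> prime_factors (group_exp G)"
  proof
    fix p assume "p \<in> prime_factors (order G)"
    hence p: "prime p" "p dvd order G"
      by auto
    then obtain x where "x \<in> carrier G" "ord x = p"
      using prime_dvd_order_imp_ord_eq[OF assms] by metis
    hence "p dvd group_exp G"
      using ord_dvd_group_exp by blast
    thus "p \<in> prime_factors (group_exp G)"
      using p(1) group_exp_pos[OF assms] by (simp add: in_prime_factors_iff)
  qed
qed

text \<open>A cyclic subgroup has as many elements as the order of its generator. This covers
  \<open>n = 0\<close>, where \<open>card\<close> of an infinite subgroup and \<open>ord\<close> of
  an element of infinite order are both 0.\<close>

lemma cyclic_subgroups_of_order_eq:
  "cyclic_subgroups_of_order G n = {generate G {a} |a. a \<in> carrier G \<and> ord a = n}"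
proof (intro equalityI subsetI)
  fix H assume "H \<in> cyclic_subgroups_of_order G n"
  hence H: "subgroup H G" "cyclic_group (G\<lparr>carrier := H\<rparr>)" "card H = n"
    by (auto simp: cyclic_subgroups_of_order_def)
  then obtain a where a: "a \<in> H" "carrier (subgroup_generated (G\<lparr>carrier := H\<rparr>) {a}) = H"
    by (auto simp: cyclic_group_def)
  have aG: "a \<in> carrier G"
    using a(1) subgroup.subset[OF H(1)] by blast
  have "generate G {a} = H"
    using a generate_consistent[of "{a}" H] H(1) by (simp add: carrier_subgroup_generated)
  thus "H \<in> {generate G {a} |a. a \<in> carrier G \<and> ord a = n}"
    using aG generate_pow_card[OF aG] H(3) by blast
next
  fix H assume "H \<in> {generate G {a} |a. a \<in> carrier G \<and> ord a = n}"
  then obtain a where a: "a \<in> carrier G" "ord a = n" "H = generate G {a}"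
    by blast
  have "subgroup H G"
    using a generate_is_subgroup by simp
  moreover have "cyclic_group (G\<lparr>carrier := H\<rparr>)"
    using cyclic_group_generated[of a] a by (simp add: subgroup_generated_def)
  ultimately show "H \<in> cyclic_subgroups_of_order G n"
    using a generate_pow_card by (simp add: cyclic_subgroups_of_order_def)
qed

text \<open>The power \<open>a [^] k\<close> has the same order as \<open>a\<close> exactly when
  \<open>k\<close> is coprime to \<open>ord a\<close>, so the totatives of \<open>ord a\<close>
  parametrize these elements.\<close>

lemma card_generators:
  assumes "finite (carrier G)" "a \<in> carrier G"
  shows "card {x \<in> generate G {a}. ord x = ord a} = totient (ord a)"
proof -
  have pos: "ord a \<ge> 1"
    using ord_ge_1 assms by blast
  have "{x \<in> generate G {a}. ord x = ord a} = (\<lambda>k. a [^] k) ` totatives (ord a)"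
  proof (intro equalityI subsetI)
    fix x assume "x \<in> {x \<in> generate G {a}. ord x = ord a}"
    then obtain k :: nat where k: "x = a [^] k" "ord x = ord a"
      using generate_pow_on_finite_carrier[OF assms] by auto
    hence cop: "coprime k (ord a)"
      using pow_ord_eq_ord_iff[OF assms] by simp
    show "x \<in> (\<lambda>k. a [^] k) ` totatives (ord a)"
    \<comment> \<open>Totatives start at 1, so the reduced exponent \<open>k mod ord a\<close> must
      be nonzero. Coprimality ensures this unless \<open>ord a = 1\<close>, where the only totative
      is 1 itself.\<close>
    proof (cases "ord a = 1")
      case True
      thus ?thesis using k assms ord_eq_1 by (auto simp: totatives_def)
    next
      case False
      have "x = a [^] (k mod ord a)"
      proof -
        have "a [^] k = (a [^] ord a) [^] (k div ord a) \<otimes> a [^] (k mod ord a)"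
          using assms(2) by (simp only: nat_pow_pow nat_pow_mult mult_div_mod_eq)
        thus ?thesis using k assms(2) by simp
      qed
      moreover have "k mod ord a \<in> totatives (ord a)"
      proof -
        have c: "coprime (k mod ord a) (ord a)"
          using cop pos by (simp add: coprime_mod_left_iff)
        hence "k mod ord a \<noteq> 0"
          using False by (auto intro: ccontr)
        moreover have "k mod ord a \<le> ord a"
          using pos by (intro less_imp_le mod_less_divisor) simp
        ultimately show ?thesis
          using c by (simp add: totatives_def)
      qed
      ultimately show ?thesis by blast
    qed
  next
    fix x assume "x \<in> (\<lambda>k. a [^] k) ` totatives (ord a)"
    then obtain k where k: "x = a [^] k" "coprime k (ord a)"
      by (auto simp: totatives_def)
    thus "x \<in> {x \<in> generate G {a}. ord x = ord a}"
      using pow_ord_eq_ord_iff[OF assms] generate_pow_on_finite_carrier[OF assms] by auto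
  qed
  moreover have "inj_on (\<lambda>k. a [^] k) (totatives (ord a))"
    using ord_inj'[OF assms(2)] by (rule inj_on_subset) (auto simp: totatives_def)
  ultimately show ?thesis
    by (simp add: card_image totient_def)
qed

text \<open>Elements of order \<open>n\<close> are grouped by the subgroup they generate; each group
  consists of the generators of one cyclic subgroup.\<close>

lemma card_ord_eq:
  assumes "finite (carrier G)"
  shows "card {a \<in> carrier G. ord a = n} = card (cyclic_subgroups_of_order G n) * totient n"
proof -
  define C where "C = cyclic_subgroups_of_order G n"
  have sub: "H \<subseteq> carrier G" "finite H" if "H \<in> C" for H
    using that assms unfolding C_def cyclic_subgroups_of_order_def
    by (auto dest: subgroup.subset intro: finite_subset)
  have finC: "finite C"
    using sub(1) assms by (intro finite_subset[of C "Pow (carrier G)"]) auto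
  have "x \<in> generate G {x}" for x
    by (rule generate.incl) simp
  hence U: "{a \<in> carrier G. ord a = n} = (\<Union>H\<in>C. {x \<in> H. ord x = n})"
    using sub(1) by (auto simp: C_def cyclic_subgroups_of_order_eq)
  \<comment> \<open>An element of order \<open>n\<close> in \<open>H\<close> generates a subgroup of
    \<open>H\<close> with \<open>n = card H\<close> elements, hence all of \<open>H\<close>. So
    \<open>x\<close> determines \<open>H\<close>, which makes the union \<open>U\<close>
    disjoint.\<close>
  have gen: "H = generate G {x}" if "H \<in> C" "x \<in> H" "ord x = n" for H x
  proof -
    have H: "subgroup H G" "card H = n"
      using that(1) by (auto simp: C_def cyclic_subgroups_of_order_def)
    have "generate G {x} \<subseteq> H"
      using generate_subgroup_incl[of "{x}" H] H(1) that(2) by simp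
    moreover have "card (generate G {x}) = card H"
      using generate_pow_card[of x] H(2) that(2,3) sub(1)[OF that(1)] by auto
    ultimately show ?thesis
      using card_subset_eq sub(2)[OF that(1)] by metis
  qed
  have "card (\<Union>H\<in>C. {x \<in> H. ord x = n}) = (\<Sum>H\<in>C. card {x \<in> H. ord x = n})"
  proof (rule card_UN_disjoint[OF finC])
    show "\<forall>H\<in>C. finite {x \<in> H. ord x = n}"
      using sub(2) by simp
    show "\<forall>H\<in>C. \<forall>K\<in>C. H \<noteq> K \<longrightarrow> {x \<in> H. ord x = n} \<inter> {x \<in> K. ord x = n} = {}"
      using gen by blast
  qed
  also have "\<dots> = (\<Sum>H\<in>C. totient n)"
    using card_generators[OF assms]
    by (intro sum.cong) (auto simp: C_def cyclic_subgroups_of_order_eq)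
  finally show ?thesis
    by (simp add: U C_def)
qed

end

theorem theorem3p2:
  fixes G :: "('a, 'b) monoid_scheme"
  assumes "group G" and "finite (carrier G)"
  shows "group_phi G = totient (order G) \<longleftrightarrow>
    real (card (cyclic_subgroups_of_order G (group_exp G))) = real (order G) / real (group_exp G)"
proof -
  interpret group G by fact
  define c where "c = card (cyclic_subgroups_of_order G (group_exp G))"
  have e: "group_exp G > 0"
    using group_exp_pos assms(2) .
  have "group_phi G = c * totient (group_exp G)"
    unfolding group_phi_def c_def using card_ord_eq[OF assms(2)] .
  moreover have "real (totient (order G)) =
      real (order G) / real (group_exp G) * real (totient (group_exp G))"
    using totient_eq_if_prime_factors_eq[OF prime_factors_group_exp[OF assms(2)] e] .
  ultimately have "group_phi G = totient (order G) \<longleftrightarrow>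
      real c * real (totient (group_exp G)) =
      real (order G) / real (group_exp G) * real (totient (group_exp G))"
    by (metis of_nat_eq_iff of_nat_mult)
  \<comment> \<open>Cancellation leaves the alternative \<open>totient (group_exp G) = 0\<close>,
    which \<open>e\<close> excludes.\<close>
  also have "\<dots> \<longleftrightarrow> real c = real (order G) / real (group_exp G)"
    using e by (subst mult_cancel_right) simp
  finally show ?thesis
    unfolding c_def .
qed

end
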